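(* Let $\mathbb{X},\mathbb{Y}$ be normed linear spaces over the same field $\mathbb{K}\in\{\mathbb{R},\mathbb{C}\}$ and let $T:\mathbb{X}\to\mathbb{Y}$ be a bounded linear operator. Then $T$ is a scalar multiple of an isometry if and only if each nonzero $x\in\mathbb{X}$ is a level vector of $T$.
   Context: A semi-inner product on a normed space $\mathbb{X}$ over $\mathbb{K}$ is a function $[\cdot,\cdot]:\mathbb{X}\times\mathbb{X}\to\mathbb{K}$ such that for all $\alpha,\beta\in\mathbb{K}$, $x,y,z\in\mathbb{X}$: (1) $[\alpha x+\beta y,z]=\alpha[x,z]+\beta[y,z]$; (2) $[x,x]>0$ whenever $x\neq0$; (3) $|[x,y]|^2\le[x,x][y,y]$; (4) $[x,\alpha y]=\overline{\alpha}[x,y]$. All semi-inner products on a normed space are assumed compatible with the norm: $\|x\|=[x,x]^{1/2}$ for all $x$. For a bounded linear operator $T:\mathbb{X}\to\mathbb{Y}$, a nonzero $x\in\mathbb{X}$ is a level vector of $T$ if there exist a scalar $k$ (a level number of $T$ corresponding to $x$) and semi-inner products $[\cdot,\cdot]_{\mathbb{X}}$ on $\mathbb{X}$ and $[\cdot,\cdot]_{\mathbb{Y}}$ on $\mathbb{Y}$ with $[Ty,Tx]_{\mathbb{Y}}=k[y,x]_{\mathbb{X}}$ for all $y\in\mathbb{X}$. "$T$ is a scalar multiple of an isometry" means: there is $\lambda\ge0$ with $\|Tx\|=\lambda\|x\|$ for all $x\in\mathbb{X}$ (no surjectivity is required; the zero operator is included). *)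

theory Defs
  imports "HOL-Analysis.Analysis" "Jordan_Normal_Form.Conjugate"
begin

section \<open>The scalar field\<close>

text \<open>
  The class captures exactly the two scalar fields, the reals and the complex numbers: both are
  instances, and \<open>rc_field_real_or_complex\<close> shows that there is no other one up to isomorphism.
  The conjugation is the one of \<^theory>\<open>Jordan_Normal_Form.Conjugate\<close>, and the (partial) order is
  that of \<^theory>\<open>HOL-Library.Complex_Order\<close>: \<open>a \<le> b\<close> means that \<open>b - a\<close> is a nonnegative real.
\<close>

class rc_field = real_normed_field + conjugatable_ordered_field +
  \<comment> \<open>\<open>r *\<^sub>R 1\<close> is \<open>of_real r\<close>, which is not available inside the class\<close>
  assumes mult_conjugate_scaleR: "a * conjugate a = (norm a)\<^sup>2 *\<^sub>R 1"
    and less_eq_iff_scaleR: "a \<le> b \<longleftrightarrow> (\<exists>r\<ge>0. b = a + r *\<^sub>R 1)"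

lemma mult_conjugate_norm: "a * conjugate (a :: 'k::rc_field) = of_real ((norm a)\<^sup>2)"
  unfolding of_real_def by (rule mult_conjugate_scaleR)

lemma less_eq_iff_real: "a \<le> b \<longleftrightarrow> (\<exists>r\<ge>0. (b :: 'k::rc_field) = a + of_real r)"
  unfolding of_real_def by (rule less_eq_iff_scaleR)

instance real :: rc_field
proof
  fix a b :: real
  show "a * conjugate a = (norm a)\<^sup>2 *\<^sub>R 1"
    by (simp add: power2_eq_square)
  show "a \<le> b \<longleftrightarrow> (\<exists>r\<ge>0. b = a + r *\<^sub>R 1)"
    by (auto intro: exI[of _ "b - a"])
qed

instance complex :: rc_field
proof
  fix a b :: complex
  show "a * conjugate a = (norm a)\<^sup>2 *\<^sub>R 1"
    by (simp add: scaleR_conv_of_real flip: complex_norm_square)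
  show "a \<le> b \<longleftrightarrow> (\<exists>r\<ge>0. b = a + r *\<^sub>R 1)"
    by (auto simp: less_eq_complex_def complex_eq_iff intro: exI[of _ "Re b - Re a"])
qed

lemma rc_field_conjugate_of_real [simp]: "conjugate (of_real r :: 'k::rc_field) = of_real r"
proof (cases "r = 0")
  case False
  then have "of_real r * conjugate (of_real r :: 'k) = of_real r * of_real r"
    by (simp add: mult_conjugate_norm power2_eq_square flip: of_real_mult)
  then show ?thesis using False by simp
qed simp

lemma rc_field_real_part: "\<exists>r. a + conjugate a = (of_real r :: 'k::rc_field)"
proof -
  have "(1 + a) * conjugate (1 + a) = 1 + (a + conjugate a) + a * conjugate a"
    using rc_field_conjugate_of_real[of 1, where 'k = 'k]
    by (simp add: conjugate_dist_add algebra_simps)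
  then have "a + conjugate a = of_real ((norm (1 + a))\<^sup>2 - 1 - (norm a)\<^sup>2)"
    unfolding mult_conjugate_norm by (simp add: algebra_simps)
  then show ?thesis ..
qed

lemma rc_field_real_or_complex:
  "\<exists>f :: 'k::rc_field \<Rightarrow> complex. inj f \<and> (range f = \<real> \<or> range f = UNIV) \<and>
     (\<forall>a b. f (a + b) = f a + f b) \<and> (\<forall>a b. f (a * b) = f a * f b) \<and>
     (\<forall>r. f (of_real r) = of_real r) \<and> (\<forall>a. f (conjugate a) = cnj (f a)) \<and>
     (\<forall>a. cmod (f a) = norm a) \<and> (\<forall>a b. f a \<le> f b \<longleftrightarrow> a \<le> b)"
proof -
  have *: ?thesis
    if inj: "inj f" and ran: "range f = \<real> \<or> range f = UNIV"
      and add: "\<And>a b. f (a + b) = f a + f b"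
      and mult: "\<And>a b. f (a * b) = f a * f b" and real: "\<And>r. f (of_real r) = of_real r"
      and cnj: "\<And>a. f (conjugate a) = cnj (f a)" for f :: "'k \<Rightarrow> complex"
  proof -
    have "cmod (f a) = norm a" for a
    proof -
      have "f (a * conjugate a) = of_real ((norm a)\<^sup>2)"
        unfolding mult_conjugate_norm by (rule real)
      then have "(of_real ((cmod (f a))\<^sup>2) :: complex) = of_real ((norm a)\<^sup>2)"
        by (simp only: mult cnj complex_norm_square)
      then have "(cmod (f a))\<^sup>2 = (norm a)\<^sup>2"
        by (simp only: of_real_eq_iff)
      then show ?thesis by simp
    qed
    moreover have "f a \<le> f b \<longleftrightarrow> a \<le> b" for a b
      unfolding less_eq_iff_real[of a] less_eq_iff_real[of "f a"] real[symmetric] add[symmetric] inj_eq[OF inj] ..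
    ultimately show ?thesis
      by (intro exI[of _ f] conjI allI inj ran add mult real cnj)
  qed
  show ?thesis
  proof (cases "\<forall>a::'k. conjugate a = a")
    case True
    have "\<exists>r. a = of_real r" for a :: 'k
    proof -
      obtain r where "a + conjugate a = of_real r" using rc_field_real_part by blast
      then have "a = of_real (r / 2)" using True by (simp add: mult.commute)
      then show ?thesis ..
    qed
    then obtain h where h: "\<And>a::'k. a = of_real (h a)" by metis
    have h_real: "h (of_real r) = r" for r
      using h[of "of_real r"] by (simp only: of_real_eq_iff)
    have h_add: "h (a + b) = h a + h b" for a b
      by (metis h h_real of_real_add)
    have h_mult: "h (a * b) = h a * h b" for a b
      by (metis h h_real of_real_mult)
    show ?thesis
    proof (rule *[of "\<lambda>a. of_real (h a)"])
      show "inj (\<lambda>a. complex_of_real (h a))"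
        by (rule injI) (metis h of_real_eq_iff)
      show "range (\<lambda>a. complex_of_real (h a)) = \<real> \<or> range (\<lambda>a. complex_of_real (h a)) = UNIV"
      proof -
        have "complex_of_real r \<in> range (\<lambda>a. complex_of_real (h a))" for r
          by (rule image_eqI[of _ _ "of_real r"]) (simp_all add: h_real)
        then show ?thesis by (auto simp: Reals_def)
      qed
    qed (use True in \<open>simp_all add: h_add h_mult h_real\<close>)
  next
    case False
    then obtain a :: 'k where a: "conjugate a \<noteq> a" by blast
    define d where "d = a - conjugate a"
    have d: "d \<noteq> 0" "conjugate d = - d"
      using a conjugate_dist_add[of a "- conjugate a"] by (simp_all add: d_def conjugate_neg)
    have "d * d = - of_real ((norm d)\<^sup>2)"
      using mult_conjugate_norm[of d] unfolding d(2) by (metis minus_minus mult_minus_right)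
    define i where "i = d * of_real (inverse (norm d))"
    have i2: "i * i = - 1"
    proof -
      have "i * i = (d * d) * of_real ((inverse (norm d))\<^sup>2)"
        by (simp add: i_def power2_eq_square)
      also have "\<dots> = - of_real ((norm d)\<^sup>2 * (inverse (norm d))\<^sup>2)"
        by (simp only: \<open>d * d = _\<close> of_real_mult mult_minus_left)
      finally show ?thesis using d by (simp flip: power_mult_distrib)
    qed
    have ci: "conjugate i = - i"
      by (simp only: i_def conjugate_dist_mul d rc_field_conjugate_of_real mult_minus_left)
    define g where "g z = of_real (Re z) + i * of_real (Im z)" for z
    have g_add: "g (z + w) = g z + g w" for z w
      by (simp add: g_def algebra_simps)
    have g_mult: "g (z * w) = g z * g w" for z w
    proof -
      have "g z * g w = of_real (Re z) * of_real (Re w) + (i * i) * (of_real (Im z) * of_real (Im w))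
          + i * (of_real (Re z) * of_real (Im w) + of_real (Im z) * of_real (Re w))"
        by (simp add: g_def algebra_simps)
      then show ?thesis unfolding i2 by (simp add: g_def algebra_simps)
    qed
    have g_cnj: "g (cnj z) = conjugate (g z)" for z
      by (simp add: g_def conjugate_dist_add conjugate_dist_mul ci)
    have g_real: "g (of_real r) = of_real r" for r by (simp add: g_def)
    have "\<exists>z. g z = a" for a
    proof -
      obtain r where r: "a + conjugate a = of_real r" using rc_field_real_part by blast
      obtain s where s: "- i * a + conjugate (- i * a) = of_real s" using rc_field_real_part by blast
      have "i * of_real s = a - conjugate a"
      proof -
        have "i * of_real s = - (i * i) * a + (i * i) * conjugate a"
          by (simp add: s[symmetric] conjugate_dist_mul conjugate_neg ci algebra_simps)
        then show ?thesis by (simp add: i2)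
      qed
      then have "2 * a = of_real r + i * of_real s"
        unfolding r[symmetric] by simp
      then have "a = g (Complex (r / 2) (s / 2))"
        by (simp add: g_def field_simps flip: mult.assoc)
      then show ?thesis by metis
    qed
    then have "surj g" by (metis surj_def)
    moreover have "inj g"
    proof (rule injI)
      fix z w assume "g z = g w"
      then have 0: "g (z - w) = 0" using g_add[of "z - w" w] by simp
      have "of_real ((cmod (z - w))\<^sup>2) = g (z - w) * conjugate (g (z - w))"
        by (simp only: g_cnj[symmetric] g_mult[symmetric] complex_norm_square[symmetric] g_real)
      then show "z = w" unfolding 0 by (simp flip: of_real_power)
    qed
    ultimately have gb: "bij g" by (simp add: bij_def)
    then have g: "inv g (g z) = z" "g (inv g a) = a" for z a
      by (simp_all add: bij_is_inj bij_is_surj surj_f_inv_f)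
    show ?thesis
    proof (rule *[of "inv g"])
      show "inj (inv g)" "range (inv g) = \<real> \<or> range (inv g) = UNIV"
        using bij_imp_bij_inv[OF gb] by (simp_all add: bij_is_inj bij_is_surj)
      show "inv g (a + b) = inv g a + inv g b" for a b by (metis g g_add)
      show "inv g (a * b) = inv g a * inv g b" for a b by (metis g g_mult)
      show "inv g (of_real r) = of_real r" for r by (metis g g_real)
      show "inv g (conjugate a) = cnj (inv g a)" for a by (metis g g_cnj)
    qed
  qed
qed

section \<open>Normed spaces, operators and semi-inner products over the scalar field\<close>

text \<open>
  The class \<^class>\<open>real_normed_vector\<close> provides addition and norm; the scalar multiplication over
  \<open>'k\<close> is the locale parameter. Its restriction to the real scalars is necessarily the one of
  the class (lemma \<open>scale_of_real\<close>).
\<close>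

locale normed_space = vector_space scale
  for scale :: "'k::rc_field \<Rightarrow> 'x::real_normed_vector \<Rightarrow> 'x" +
  assumes norm_scale: "norm (scale a x) = norm a * norm x"
begin

lemma scale_of_real: "scale (of_real r) x = r *\<^sub>R x"
proof -
  define f where "f r = scale (of_real r) x - r *\<^sub>R x" for r
  have f_add: "f (r + s) = f r + f s" for r s
    by (simp add: f_def scale_left_distrib algebra_simps)
  have f_0: "f 0 = 0" by (simp add: f_def)
  have f_nat: "f (of_nat n * r) = of_nat n *\<^sub>R f r" for n r
    by (induction n) (simp_all add: f_0 f_add distrib_right scaleR_left_distrib)
  have f_1: "f 1 = 0" by (simp add: f_def)
  have bound: "norm (f r) \<le> 2 * norm x * \<bar>r\<bar>" for r
    using norm_triangle_ineq4[of "scale (of_real r) x" "r *\<^sub>R x"]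
    by (simp add: f_def norm_scale mult.commute mult.left_commute)
  have f_of_nat: "f (of_nat n) = 0" for n
    using f_nat[of n 1] by (simp add: f_1)
  have f_minus: "f (- r) = - f r" for r
    by (simp add: f_def)
  have f_int: "f (of_int m) = 0" for m
  proof (cases m rule: int_cases2)
    case (nonneg n) then show ?thesis by (simp add: f_of_nat)
  next
    case (nonpos n) then show ?thesis by (simp add: f_of_nat f_minus)
  qed
  have "real n * norm (f r) \<le> 2 * norm x" for n
  proof -
    have "real n * norm (f r) = norm (f (real n * r))" by (simp add: f_nat)
    also have "f (real n * r) = f (of_int \<lfloor>real n * r\<rfloor> + frac (real n * r))"
      by (simp add: frac_def)
    also have "\<dots> = f (frac (real n * r))" unfolding f_add f_int by simp
    also have "norm \<dots> \<le> 2 * norm x * \<bar>frac (real n * r)\<bar>" by (rule bound)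
    also have "\<dots> \<le> 2 * norm x"
      using frac_lt_1[of "real n * r"] frac_ge_0[of "real n * r"]
      by (intro mult_left_le) auto
    finally show ?thesis .
  qed
  then have "norm (f r) = 0"
    by (metis norm_ge_zero less_eq_real_def not_le reals_Archimedean3)
  then show ?thesis by (simp add: f_def)
qed

end

lemma normed_space_real: "normed_space (scaleR :: real \<Rightarrow> 'x::real_normed_vector \<Rightarrow> 'x)"
  by unfold_locales (simp_all add: algebra_simps)

locale bounded_operator =
  X: normed_space scaleX + Y: normed_space scaleY + Vector_Spaces.linear scaleX scaleY T
  for scaleX :: "'k::rc_field \<Rightarrow> 'x::real_normed_vector \<Rightarrow> 'x"
    and scaleY :: "'k \<Rightarrow> 'y::real_normed_vector \<Rightarrow> 'y"
    and T :: "'x \<Rightarrow> 'y" +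
  assumes bounded: "\<exists>B. \<forall>x. norm (T x) \<le> B * norm x"

locale semi_inner_product = normed_space scale
  for scale :: "'k::rc_field \<Rightarrow> 'x::real_normed_vector \<Rightarrow> 'x"
    and sip :: "'x \<Rightarrow> 'x \<Rightarrow> 'k" +
  assumes sip_linear: "sip (scale a x + scale b y) z = a * sip x z + b * sip y z"
    and sip_positive: "x \<noteq> 0 \<Longrightarrow> sip x x > 0"
    and sip_Cauchy_Schwarz: "of_real ((norm (sip x y))\<^sup>2) \<le> sip x x * sip y y"
    and sip_conjugate: "sip x (scale a y) = conjugate a * sip x y"
    \<comment> \<open>compatibility with the norm; the root is avoided by squaring\<close>
    and sip_compatible: "of_real ((norm x)\<^sup>2) = sip x x"

definition level_vector ::
  "('k::rc_field \<Rightarrow> 'x::real_normed_vector \<Rightarrow> 'x) \<Rightarrow> ('k \<Rightarrow> 'y::real_normed_vector \<Rightarrow> 'y) \<Rightarrow>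
   ('x \<Rightarrow> 'y) \<Rightarrow> 'x \<Rightarrow> bool" where
  "level_vector scaleX scaleY T x \<longleftrightarrow> x \<noteq> 0 \<and>
     (\<exists>k sipX sipY. semi_inner_product scaleX sipX \<and> semi_inner_product scaleY sipY \<and>
        (\<forall>y. sipY (T y) (T x) = k * sipX y x))"

definition scalar_multiple_of_isometry ::
  "('x::real_normed_vector \<Rightarrow> 'y::real_normed_vector) \<Rightarrow> bool" where
  "scalar_multiple_of_isometry T \<longleftrightarrow> (\<exists>c\<ge>0. \<forall>x. norm (T x) = c * norm x)"

end

theory Submission
  imports Defs
begin

text \<open>
  If \<open>\<parallel>T x\<parallel> = c \<parallel>x\<parallel>\<close> with \<open>c > 0\<close>, a support functional \<open>g\<close> at \<open>T x\<close> pulls back to the support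
  functional \<open>(g \<circ> T) / c\<^sup>2\<close> at \<open>x\<close>, and any support functional at one nonzero vector extends to a
  semi-inner product: choose, by Hahn-Banach, a support functional at one representative of every
  other line and extend it conjugate-linearly along the line. Hahn-Banach itself is obtained from
  the fact that a minimal sublinear functional is linear.

  Conversely, if all vectors are level vectors, then each \<open>p \<noteq> 0\<close> has a norm support functional
  \<open>\<phi>\<close> such that \<open>(\<parallel>T p\<parallel> / \<parallel>p\<parallel>) \<phi>\<close> supports the seminorm \<open>\<parallel>T \<cdot>\<parallel>\<close> at \<open>p\<close>. Along a segment avoiding
  the origin the two convex functions \<open>\<parallel>\<cdot>\<parallel>\<close> and \<open>\<parallel>T \<cdot>\<parallel>\<close> therefore have the same logarithmic
  derivative, so that their ratio is constant.
\<close>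

section \<open>Support functionals\<close>

definition sublinear :: "('a::real_vector \<Rightarrow> real) \<Rightarrow> bool" where
  "sublinear p \<longleftrightarrow> (\<forall>x y. p (x + y) \<le> p x + p y) \<and> (\<forall>c x. c \<ge> 0 \<longrightarrow> p (c *\<^sub>R x) = c * p x)"

lemma sublinear_add: "sublinear p \<Longrightarrow> p (x + y) \<le> p x + p y"
  and sublinear_scaleR: "sublinear p \<Longrightarrow> c \<ge> 0 \<Longrightarrow> p (c *\<^sub>R x) = c * p x"
  by (auto simp: sublinear_def)

lemma sublinear_zero: "sublinear p \<Longrightarrow> p 0 = 0"
  using sublinear_scaleR[of p 0 0] by simp

lemma sublinear_ge: "sublinear p \<Longrightarrow> - p (- x) \<le> p x"
  using sublinear_add[of p x "- x"] sublinear_zero[of p] by simp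

text \<open>Scaling by \<open>c\<close> and then by \<open>inverse c\<close> turns the one-sided
  estimate \<open>scale\<close> into equality, so positive homogeneity only has to be checked in one
  direction.\<close>

lemma sublinearI:
  assumes add: "\<And>x y. p (x + y) \<le> p x + p y"
    and scale: "\<And>c x. c > 0 \<Longrightarrow> p (c *\<^sub>R x) \<le> c * p x"
    and zero: "p 0 = 0"
  shows "sublinear p"
proof -
  have "p (c *\<^sub>R x) = c * p x" if "c \<ge> 0" for c x
  proof (cases "c = 0")
    case False
    then have "c > 0" using that by simp
    then have "p x \<le> inverse c * p (c *\<^sub>R x)"
      using scale[of "inverse c" "c *\<^sub>R x"] by simp
    then have "c * p x \<le> p (c *\<^sub>R x)"
      using \<open>c > 0\<close> by (simp add: field_simps)
    with scale[OF \<open>c > 0\<close>, of x] show ?thesis by simp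
  qed (simp add: zero)
  with add show ?thesis by (simp add: sublinear_def)
qed

lemma sublinear_norm: "sublinear norm"
  by (simp add: sublinear_def norm_triangle_ineq)

section \<open>Infima of chains and minimal sublinear functionals\<close>

text \<open>Provides the bounds of chains for Zorn's lemma. The infimum is finite because
  \<open>q x\<close> is at least \<open>- q (- x)\<close>, hence at least \<open>- p (- x)\<close>.
  For subadditivity, the smaller of two members of the chain serves at both arguments.\<close>

lemma sublinear_INF_chain:
  assumes "C \<noteq> {}" and sub: "\<And>q. q \<in> C \<Longrightarrow> sublinear q"
    and chain: "\<And>q r. q \<in> C \<Longrightarrow> r \<in> C \<Longrightarrow> q \<le> r \<or> r \<le> q"
    and le: "\<And>q. q \<in> C \<Longrightarrow> q \<le> p"
  shows "sublinear (\<lambda>x. INF q\<in>C. q x)" and "q \<in> C \<Longrightarrow> (INF q\<in>C. q x) \<le> q x"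
proof -
  have bdd: "bdd_below ((\<lambda>q. q x) ` C)" for x
  proof (rule bdd_belowI2)
    fix q assume "q \<in> C"
    then show "- p (- x) \<le> q x"
      using sublinear_ge[OF sub, of q x] le[THEN le_funD, of q "- x"] by linarith
  qed
  have lower: "(INF q\<in>C. q x) \<le> q x" if "q \<in> C" for q x
    using bdd that by (rule cINF_lower)
  then show "q \<in> C \<Longrightarrow> (INF q\<in>C. q x) \<le> q x" .
  show "sublinear (\<lambda>x. INF q\<in>C. q x)"
  proof (rule sublinearI)
    fix x y
    have *: "(INF q\<in>C. q (x + y)) \<le> q x + r y" if "q \<in> C" "r \<in> C" for q r
    proof -
      from chain[OF that] that obtain s where s: "s \<in> C" "s \<le> q" "s \<le> r" by auto
      have "(INF q\<in>C. q (x + y)) \<le> s x + s y"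
        using lower[OF s(1), of "x + y"] sublinear_add[OF sub[OF s(1)], of x y] by linarith
      then show ?thesis using le_funD[OF s(2), of x] le_funD[OF s(3), of y] by linarith
    qed
    have "(INF q\<in>C. q (x + y)) - q x \<le> (INF q\<in>C. q y)" if "q \<in> C" for q
      using *[OF that] by (intro cINF_greatest[OF \<open>C \<noteq> {}\<close>]) (simp add: algebra_simps)
    then have "(INF q\<in>C. q (x + y)) - (INF q\<in>C. q y) \<le> (INF q\<in>C. q x)"
      by (intro cINF_greatest[OF \<open>C \<noteq> {}\<close>]) (simp add: algebra_simps)
    then show "(INF q\<in>C. q (x + y)) \<le> (INF q\<in>C. q x) + (INF q\<in>C. q y)" by simp
  next
    fix c :: real and x assume "c > 0"
    have "(INF q\<in>C. q (c *\<^sub>R x)) / c \<le> (INF q\<in>C. q x)"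
    proof (rule cINF_greatest[OF \<open>C \<noteq> {}\<close>])
      fix q assume "q \<in> C"
      then show "(INF q\<in>C. q (c *\<^sub>R x)) / c \<le> q x"
        using lower[of q "c *\<^sub>R x"] sublinear_scaleR[OF sub, of q c x] \<open>c > 0\<close>
        by (simp add: field_simps)
    qed
    then show "(INF q\<in>C. q (c *\<^sub>R x)) \<le> c * (INF q\<in>C. q x)"
      using \<open>c > 0\<close> by (simp add: field_simps)
  next
    have "(INF q\<in>C. q 0) = (INF q\<in>C. 0 :: real)"
      by (rule INF_cong) (simp_all add: sub sublinear_zero)
    then show "(INF q\<in>C. q 0) = 0" using \<open>C \<noteq> {}\<close> by simp
  qed
qed

lemma minimal_sublinear_exists:
  assumes "sublinear p"
  obtains q where "sublinear q" "q \<le> p" "\<And>r. sublinear r \<Longrightarrow> r \<le> q \<Longrightarrow> r = q"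
proof -
  let ?A = "{q. sublinear q \<and> q \<le> p}"
  have "\<exists>m\<in>?A. \<forall>q\<in>?A. m \<ge> q \<longrightarrow> q = m"
  proof (rule predicate_Zorn)
    show "partial_order_on ?A (relation_of (\<ge>) ?A)"
      by (rule partial_order_on_relation_ofI) (auto intro: order_trans)
    fix C assume C: "C \<in> Chains (relation_of (\<ge>) ?A)"
    show "\<exists>u\<in>?A. \<forall>q\<in>C. q \<ge> u"
    proof (cases "C = {}")
      case True
      with assms show ?thesis by auto
    next
      case False
      have mem: "sublinear q" "q \<le> p" if "q \<in> C" for q
        using C that by (auto simp: Chains_def relation_of_def)
      have chain: "q \<le> r \<or> r \<le> q" if "q \<in> C" "r \<in> C" for q r
        using C that by (auto simp: Chains_def relation_of_def)
      let ?u = "\<lambda>x. INF q\<in>C. q x"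
      have "sublinear ?u" using False mem(1) chain mem(2) by (rule sublinear_INF_chain(1))
      moreover have le: "?u \<le> q" if "q \<in> C" for q
        using sublinear_INF_chain(2)[OF False mem(1) chain mem(2) that] by (simp add: le_fun_def)
      moreover obtain q where "q \<in> C" using False by blast
      then have "?u \<le> p" using le[of q] mem(2)[of q] by (meson order_trans)
      ultimately show ?thesis by blast
    qed
  qed
  then show thesis using that by (blast intro: order_trans)
qed

section \<open>Hahn-Banach by sliding\<close>

text \<open>Take the infimum of \<open>p (x + t *\<^sub>R v) - t * p v\<close> over
  \<open>t \<ge> 0\<close>. The parameters of two arguments add up, which gives subadditivity;
  \<open>t = 0\<close> shows \<open>q \<le> p\<close>, and \<open>t = 1\<close> at
  \<open>- v\<close> gives the last bound.\<close>

lemma sublinear_slide: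
  fixes v :: "'a::real_vector"
  assumes p: "sublinear p"
  obtains q where "sublinear q" "q \<le> p" "q (- v) \<le> - p v"
proof -
  let ?f = "\<lambda>x t. p (x + t *\<^sub>R v) - t * p v"
  let ?q = "\<lambda>x. INF t\<in>{0..}. ?f x t"
  have ne: "{0::real..} \<noteq> {}" by auto
  have bdd: "bdd_below (?f x ` {0..})" for x
  proof (rule bdd_belowI2)
    fix t :: real assume "t \<in> {0..}"
    then have "t * p v = p (t *\<^sub>R v)" using sublinear_scaleR[OF p] by simp
    then show "- p (- x) \<le> ?f x t"
      using sublinear_add[OF p, of "x + t *\<^sub>R v" "- x"] by simp
  qed
  have lower: "?q x \<le> ?f x t" if "t \<ge> 0" for x t
    using bdd by (rule cINF_lower) (use that in simp)
  have "sublinear ?q"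
  proof (rule sublinearI)
    fix x y
    have *: "?q (x + y) \<le> ?f x s + ?f y t" if "s \<ge> 0" "t \<ge> 0" for s t
    proof -
      have "?q (x + y) \<le> p (x + y + (s + t) *\<^sub>R v) - (s + t) * p v"
        using that by (intro lower) simp
      also have "x + y + (s + t) *\<^sub>R v = (x + s *\<^sub>R v) + (y + t *\<^sub>R v)"
        by (simp add: algebra_simps)
      finally show ?thesis
        using sublinear_add[OF p, of "x + s *\<^sub>R v" "y + t *\<^sub>R v"] by (simp add: algebra_simps)
    qed
    have "?q (x + y) - ?f x s \<le> ?q y" if "s \<ge> 0" for s
      using *[OF that] by (intro cINF_greatest[OF ne]) (simp add: algebra_simps)
    then have "?q (x + y) - ?q y \<le> ?q x"
      by (intro cINF_greatest[OF ne]) (simp add: algebra_simps)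
    then show "?q (x + y) \<le> ?q x + ?q y" by simp
  next
    fix c :: real and x assume "c > 0"
    have "?q (c *\<^sub>R x) / c \<le> ?q x"
    proof (rule cINF_greatest[OF ne])
      fix t :: real assume "t \<in> {0..}"
      \<comment> \<open>Stretching \<open>x\<close> by \<open>c\<close> stretches the slide
        parameter as well, hence \<open>c * t\<close>.\<close>
      then have "?q (c *\<^sub>R x) \<le> ?f (c *\<^sub>R x) (c * t)" using \<open>c > 0\<close> by (intro lower) simp
      also have "\<dots> = c * ?f x t"
        using sublinear_scaleR[OF p, of c "x + t *\<^sub>R v"] \<open>c > 0\<close> by (simp add: algebra_simps)
      finally show "?q (c *\<^sub>R x) / c \<le> ?f x t" using \<open>c > 0\<close> by (simp add: field_simps)
    qed
    then show "?q (c *\<^sub>R x) \<le> c * ?q x" using \<open>c > 0\<close> by (simp add: field_simps)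
  next
    have "?q 0 = (INF t\<in>{0::real..}. 0 :: real)"
      by (rule INF_cong) (simp_all add: sublinear_scaleR[OF p])
    then show "?q 0 = 0" by simp
  qed
  moreover have "?q \<le> p" using lower[of 0] by (auto simp: le_fun_def)
  moreover have "?q (- v) \<le> - p v" using lower[of 1 "- v"] sublinear_zero[OF p] by simp
  ultimately show thesis by (rule that)
qed

text \<open>Sliding a minimal sublinear functional along \<open>v\<close> does not change it, so it is odd.\<close>

lemma linear_below_sublinear:
  assumes "sublinear p"
  obtains u where "linear u" "u \<le> p"
proof -
  obtain q where q: "sublinear q" "q \<le> p" and min: "\<And>r. sublinear r \<Longrightarrow> r \<le> q \<Longrightarrow> r = q"
    using minimal_sublinear_exists[OF assms] by blast
  have odd: "q (- v) = - q v" for v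
  proof -
    obtain r where "sublinear r" "r \<le> q" "r (- v) \<le> - q v" using sublinear_slide[OF q(1)] by blast
    then show ?thesis using min[of r] sublinear_ge[OF q(1), of v] by simp
  qed
  have "linear q"
  proof (rule linearI)
    show "q (x + y) = q x + q y" for x y
      using sublinear_add[OF q(1), of x y] sublinear_add[OF q(1), of "- x" "- y"] odd[of "x + y"]
      by (simp add: odd)
    show "q (c *\<^sub>R x) = c *\<^sub>R q x" for c x
      using sublinear_scaleR[OF q(1), of c x] sublinear_scaleR[OF q(1), of "- c" x] odd[of "c *\<^sub>R x"]
      by (cases "c \<ge> 0") simp_all
  qed
  then show thesis using q(2) that by blast
qed

text \<open>Sliding the norm along \<open>x\<close> first forces every linear functional below the
  result to take at least the value \<open>norm x\<close> at \<open>x\<close>.\<close>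

lemma real_support_functional:
  fixes x :: "'a::real_normed_vector"
  obtains u where "linear u" "\<And>y. u y \<le> norm y" "u x = norm x"
proof -
  obtain p where p: "sublinear p" "p \<le> norm" "p (- x) \<le> - norm x"
    using sublinear_slide[OF sublinear_norm] by blast
  obtain u where u: "linear u" "u \<le> p" using linear_below_sublinear[OF p(1)] .
  have le: "u y \<le> norm y" for y using u(2) p(2) by (meson le_funD order_trans)
  have "u (- x) \<le> - norm x" using le_funD[OF u(2), of "- x"] p(3) by linarith
  then have "u x = norm x" using le[of x] linear_neg[OF u(1), of x] by simp
  then show thesis using u(1) le that by blast
qed

section \<open>Real and imaginary parts in the scalar field\<close>

text \<open>Serves to extract real-linear functionals from semi-inner products.\<close>

lemma rc_field_re:
  obtains re :: "'k::rc_field \<Rightarrow> real" where "\<And>a b. re (a + b) = re a + re b"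
    "\<And>r a. re (of_real r * a) = r * re a" "\<And>r. re (of_real r) = r" "\<And>a. \<bar>re a\<bar> \<le> norm a"
proof -
  obtain f :: "'k \<Rightarrow> complex" where f: "\<And>a b. f (a + b) = f a + f b"
    "\<And>a b. f (a * b) = f a * f b" "\<And>r. f (of_real r) = of_real r" "\<And>a. cmod (f a) = norm a"
    using rc_field_real_or_complex by metis
  show thesis
  proof (rule that[of "\<lambda>a. Re (f a)"])
    show "\<bar>Re (f a)\<bar> \<le> norm a" for a using abs_Re_le_cmod[of "f a"] f(4) by simp
  qed (simp_all add: f)
qed

text \<open>Over the reals \<open>j = 0\<close>, over the complex numbers \<open>j\<close> is the imaginary unit.\<close>

lemma rc_field_imaginary_unit:
  obtains j :: "'k::rc_field" where "j = 0 \<or> j * j = - 1" "conjugate j = - j"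
    "\<And>a. \<exists>r s. a = of_real r + j * of_real s"
proof -
  obtain f :: "'k \<Rightarrow> complex" where f: "inj f" "range f = \<real> \<or> range f = UNIV"
    "\<And>a b. f (a + b) = f a + f b" "\<And>a b. f (a * b) = f a * f b"
    "\<And>r. f (of_real r) = of_real r" "\<And>a. f (conjugate a) = cnj (f a)"
    using rc_field_real_or_complex[where ?'k = 'k] by blast
  from f(2) show thesis
  proof
    assume R: "range f = \<real>"
    have "\<exists>r. a = of_real r" for a :: 'k
    proof -
      have "f a \<in> \<real>" using R by blast
      then obtain r where "f a = f (of_real r)" unfolding f(5) by (rule Reals_cases)
      then show ?thesis using f(1) by (auto simp: inj_eq)
    qed
    then show thesis by (intro that[of 0]) auto
  next
    assume "range f = UNIV"
    then obtain j where j: "f j = \<i>" by (metis surjD)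
    have neg: "f (- a) = - f a" for a :: 'k using f(4)[of "of_real (-1)" a] f(5)[of "-1"] by simp
    show thesis
    proof (rule that[of j])
      have "j * j = - 1" using f(1)
        by (rule injD) (use f(5)[of 1] in \<open>simp add: f(4) j neg\<close>)
      then show "j = 0 \<or> j * j = - 1" ..
      show "conjugate j = - j" using f(1) by (rule injD) (simp add: f(6) j neg)
      fix a :: 'k
      have "a = of_real (Re (f a)) + j * of_real (Im (f a))"
        using f(1) by (rule injD) (simp add: f(3-5) j complex_eq)
      then show "\<exists>r s. a = of_real r + j * of_real s" by blast
    qed
  qed
qed

lemma norm_conjugate [simp]: "norm (conjugate a) = norm (a :: 'k::rc_field)"
proof (cases "a = 0")
  case False
  have "norm a * norm (conjugate a) = norm a * norm a"
    unfolding norm_mult[symmetric] mult_conjugate_norm by (simp add: norm_mult power2_eq_square)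
  then show ?thesis using False by simp
qed simp

section \<open>Semi-inner products with a prescribed support functional\<close>

text \<open>Normalised like \<open>\<lambda>y. sip y z\<close> for a compatible semi-inner product:
  the dual norm is \<open>norm z\<close>, not 1, and for \<open>z = 0\<close> only the zero
  functional qualifies.\<close>

definition (in normed_space) support_functional :: "'x \<Rightarrow> ('x \<Rightarrow> 'k) \<Rightarrow> bool" where
  "support_functional z f \<longleftrightarrow>
     (\<forall>a b x y. f (scale a x + scale b y) = a * f x + b * f y) \<and>
     (\<forall>y. norm (f y) \<le> norm z * norm y) \<and> f z = of_real ((norm z)\<^sup>2)"

context normed_space
begin

text \<open>The Bohnenblust-Sobczyk construction: a real support functional \<open>u\<close> becomes
  the real part of \<open>f\<close>. With \<open>j = 0\<close> this is \<open>u\<close> itself, so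
  both scalar fields are treated at once.\<close>

lemma support_functional_exists: "\<exists>f. support_functional z f"
proof -
  obtain u where u: "linear u" "\<And>y. u y \<le> norm y" "u z = norm z"
    using real_support_functional by blast
  obtain j :: 'k where j: "j = 0 \<or> j * j = - 1" "conjugate j = - j"
    and re_im: "\<And>a. \<exists>r s. a = of_real r + j * of_real s"
    using rc_field_imaginary_unit by blast
  define f where "f y = of_real (u y) - j * of_real (u (scale j y))" for y
  have f_add: "f (x + y) = f x + f y" for x y
    by (simp add: f_def scale_right_distrib linear_add[OF u(1)] algebra_simps)
  have f_real: "f (scale (of_real r) y) = of_real r * f y" for r y
  proof -
    have "scale j (scale (of_real r) y) = r *\<^sub>R scale j y"
      by (metis scale_left_commute scale_of_real)
    then show ?thesis
      by (simp add: f_def scale_of_real linear_scale[OF u(1)] algebra_simps)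
  qed
  have f_j: "f (scale j y) = j * f y" for y
    using j(1)
  proof
    assume "j * j = - 1"
    then have "f (scale j y) = of_real (u (scale j y)) + j * of_real (u y)"
      by (simp add: f_def linear_neg[OF u(1)])
    moreover have "j * f y = j * of_real (u y) - (j * j) * of_real (u (scale j y))"
      by (simp add: f_def algebra_simps)
    ultimately show ?thesis using \<open>j * j = - 1\<close> by simp
  qed (simp add: f_def linear_0[OF u(1)])
  have f_scale: "f (scale a y) = a * f y" for a y
  proof -
    obtain r s where a: "a = of_real r + j * of_real s" using re_im by blast
    have "scale a y = scale (of_real r) y + scale j (scale (of_real s) y)"
      by (simp add: a scale_left_distrib)
    then have "f (scale a y) = of_real r * f y + j * (of_real s * f y)"
      by (simp only: f_add f_j f_real)
    then show ?thesis by (simp add: a algebra_simps)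
  qed
  have f_conj: "conjugate (f y) = of_real (u y) + j * of_real (u (scale j y))" for y
    using conjugate_dist_add[of "of_real (u y)" "- (j * of_real (u (scale j y)))"]
    by (simp add: f_def conjugate_neg conjugate_dist_mul j(2))
  have f_le: "norm (f y) \<le> norm y" for y
  proof (cases "f y = 0")
    case False
    \<comment> \<open>rotate \<open>y\<close> so that \<open>f\<close> becomes real and agrees with its real part \<open>u\<close>\<close>
    define a where "a = conjugate (f y) / of_real (norm (f y))"
    have "norm a = 1" using False by (simp add: a_def norm_divide)
    have "f (scale a y) = (f y * conjugate (f y)) / of_real (norm (f y))"
      by (simp add: f_scale a_def)
    then have f_w: "f (scale a y) = of_real (norm (f y))"
      using False by (simp add: mult_conjugate_norm power2_eq_square)
    have "f (scale a y) + conjugate (f (scale a y)) = 2 * of_real (u (scale a y))"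
      unfolding f_conj by (simp add: f_def)
    then have "(of_real (2 * norm (f y)) :: 'k) = of_real (2 * u (scale a y))"
      unfolding f_w by simp
    then have "2 * norm (f y) = 2 * u (scale a y)" by (simp only: of_real_eq_iff)
    then show ?thesis using u(2)[of "scale a y"] \<open>norm a = 1\<close> by (simp add: norm_scale)
  qed simp
  \<comment> \<open>The real part of \<open>f z\<close> is already \<open>norm z\<close>, so the
    bound \<open>f_le\<close> leaves no room for an imaginary part \<open>?s\<close>.\<close>
  have f_z: "f z = of_real (norm z)"
    using j(1)
  proof
    assume jj: "j * j = - 1"
    let ?s = "u (scale j z)"
    have "f z * conjugate (f z) = of_real (norm z) * of_real (norm z) - (j * j) * (of_real ?s * of_real ?s)"
      unfolding f_conj by (simp add: f_def u(3) algebra_simps)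
    then have "of_real ((norm (f z))\<^sup>2) = (of_real ((norm z)\<^sup>2 + ?s\<^sup>2) :: 'k)"
      unfolding mult_conjugate_norm jj by (simp add: power2_eq_square)
    then have "(norm (f z))\<^sup>2 = (norm z)\<^sup>2 + ?s\<^sup>2" by (simp only: of_real_eq_iff)
    moreover have "(norm (f z))\<^sup>2 \<le> (norm z)\<^sup>2" using f_le by (intro power_mono) simp_all
    ultimately show ?thesis by (simp add: f_def u(3))
  qed (simp add: f_def u(3))
  have "support_functional z (\<lambda>y. of_real (norm z) * f y)"
    unfolding support_functional_def
    using f_le f_z
    by (auto simp: f_add f_scale norm_mult power2_eq_square distrib_left mult.left_commute intro: mult_left_mono)
  then show ?thesis by blast
qed

lemma semi_inner_product_extending:
  assumes "x \<noteq> 0" and f: "support_functional x f"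
  obtains sip where "semi_inner_product scale sip" "\<And>y. sip y x = f y"
proof -
  define F where "F = (\<lambda>z. SOME g. support_functional z g)(x := f)"
  have F: "support_functional z (F z)" for z
    using f someI_ex[OF support_functional_exists[of z]] by (simp add: F_def)
  then have F_lin: "F z (scale a v + scale b w) = a * F z v + b * F z w"
    and F_le: "norm (F z w) \<le> norm z * norm w"
    and F_self: "F z z = of_real ((norm z)\<^sup>2)" for z a b v w
    by (auto simp: support_functional_def)
  have F_0: "F 0 w = 0" for w using F_le[of 0 w] by simp
  have F_scale: "F z (scale a w) = a * F z w" for z a w
    using F_lin[of z a w 0 w] by simp
  \<comment> \<open>\<open>R z\<close> is the representative of the punctured line \<open>L z\<close>; that of \<open>L x\<close> is \<open>x\<close>\<close>
  define L where "L z = (\<lambda>a. scale a z) ` (- {0})" for z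
  define R where "R z = (if x \<in> L z then x else SOME w. w \<in> L z)" for z
  have L_scale: "L (scale b z) = L z" if "b \<noteq> 0" for b z
  proof -
    have "L (scale b z) = (\<lambda>a. scale a z) ` (\<lambda>a. a * b) ` (- {0})"
      by (simp add: L_def image_image)
    also have "(\<lambda>a. a * b) ` (- {0}) = - {0}"
    proof -
      have "a \<in> (\<lambda>a. a * b) ` (- {0})" if "a \<noteq> 0" for a
        using that \<open>b \<noteq> 0\<close> by (intro image_eqI[of _ _ "a / b"]) auto
      then show ?thesis using that by auto
    qed
    finally show ?thesis by (simp add: L_def)
  qed
  have L_self: "z \<in> L z" for z
    unfolding L_def by (rule image_eqI[of _ _ 1]) simp_all
  have R_L: "R z \<in> L z" for z
    using L_self[of z] by (auto simp: R_def intro: someI)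
  have R_scale: "R (scale b z) = R z" if "b \<noteq> 0" for b z
    using that by (simp add: R_def L_scale)
  have R_x: "R x = x" by (simp add: R_def L_self)
  have R_0: "R 0 = 0" using R_L[of 0] by (auto simp: L_def)
  have "\<exists>c. z = scale c (R z)" for z
  proof -
    obtain a where "a \<noteq> 0" "R z = scale a z" using R_L[of z] by (auto simp: L_def)
    then have "z = scale (inverse a) (R z)" by simp
    then show ?thesis ..
  qed
  then obtain c where c: "\<And>z. z = scale (c z) (R z)" by metis
  have c_scale: "c (scale b z) = b * c z" if "b \<noteq> 0" "R z \<noteq> 0" for b z
  proof -
    have "scale (c (scale b z)) (R z) = scale b z"
      using c[of "scale b z"] that by (simp add: R_scale)
    also have "\<dots> = scale (b * c z) (R z)" using c[of z] by (metis scale_scale)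
    finally show ?thesis using that by simp
  qed
  \<comment> \<open>Conjugate-linear extension along each line. At \<open>z = 0\<close> the
    coefficient \<open>c 0\<close> is arbitrary but harmless, since \<open>R 0 = 0\<close> and
    \<open>F 0\<close> vanishes.\<close>
  define sip where "sip y z = conjugate (c z) * F (R z) y" for y z
  have self: "sip z z = of_real ((norm z)\<^sup>2)" for z
  proof -
    have "sip z z = conjugate (c z) * F (R z) (scale (c z) (R z))"
      using c[of z] by (simp add: sip_def)
    also have "\<dots> = c z * conjugate (c z) * of_real ((norm (R z))\<^sup>2)"
      by (simp add: F_scale F_self)
    also have "\<dots> = of_real ((norm (scale (c z) (R z)))\<^sup>2)"
      unfolding mult_conjugate_norm norm_scale by (simp add: power_mult_distrib)
    finally show ?thesis using c[of z] by simp
  qed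
  have le: "norm (sip y z) \<le> norm y * norm z" for y z
  proof -
    have "norm (sip y z) \<le> norm (c z) * (norm (R z) * norm y)"
      using F_le[of "R z" y] by (simp add: sip_def norm_mult mult_left_mono)
    also have "\<dots> = norm (scale (c z) (R z)) * norm y" by (simp add: norm_scale)
    finally show ?thesis using c[of z] by (simp add: mult.commute)
  qed
  have "semi_inner_product scale sip"
  proof
    show "sip (scale a v + scale b w) z = a * sip v z + b * sip w z" for a b v w z
      by (simp add: sip_def F_lin algebra_simps)
    show "sip v v > 0" if "v \<noteq> 0" for v
    proof -
      have "0 \<le> sip v v"
        unfolding self less_eq_iff_real[where 'k = 'k] by (intro exI[of _ "(norm v)\<^sup>2"]) simp
      moreover have "sip v v \<noteq> 0" using that by (simp add: self)
      ultimately show ?thesis by (simp add: le_less)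
    qed
    show "of_real ((norm (sip v w))\<^sup>2) \<le> sip v v * sip w w" for v w
    proof -
      have "(norm (sip v w))\<^sup>2 \<le> (norm v * norm w)\<^sup>2" using le by (intro power_mono) simp_all
      then have "\<exists>r\<ge>0. (norm v)\<^sup>2 * (norm w)\<^sup>2 = (norm (sip v w))\<^sup>2 + r"
        by (intro exI[of _ "(norm v * norm w)\<^sup>2 - (norm (sip v w))\<^sup>2"]) (simp add: power_mult_distrib)
      then show ?thesis
        unfolding self less_eq_iff_real[where 'k = 'k] by (metis of_real_add of_real_mult)
    qed
    \<comment> \<open>\<open>c_scale\<close> covers only nonzero \<open>a\<close> and
      \<open>R w\<close>; in the remaining cases both sides are 0.\<close>
    show "sip v (scale a w) = conjugate a * sip v w" for v a w
      by (cases "a = 0"; cases "R w = 0")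
        (auto simp: sip_def R_0 F_0 R_scale c_scale conjugate_dist_mul)
    show "of_real ((norm v)\<^sup>2) = sip v v" for v by (simp add: self)
  qed
  moreover have "sip y x = f y" for y
  proof -
    have "scale (c x) x = scale 1 x" using c[of x] by (simp add: R_x)
    then have "c x = 1" using \<open>x \<noteq> 0\<close> scale_right_imp_eq by blast
    then show ?thesis
      using rc_field_conjugate_of_real[of 1, where 'k = 'k] by (simp add: sip_def R_x F_def)
  qed
  ultimately show thesis by (rule that)
qed

text \<open>Supplies the forms used for the zero operator. A space without nonzero vectors offers no
  functional to extend and carries the zero form.\<close>

lemma semi_inner_product_exists: "\<exists>sip. semi_inner_product scale sip"
proof (cases "\<exists>x::'x. x \<noteq> 0")
  case True
  then obtain x :: 'x and f where "x \<noteq> 0" "support_functional x f"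
    using support_functional_exists by blast
  then show ?thesis using semi_inner_product_extending by blast
next
  case False
  then have "semi_inner_product scale (\<lambda>x y. 0 :: 'k)"
    by unfold_locales (auto simp: less_eq_iff_real[where 'k = 'k])
  then show ?thesis by blast
qed

end

lemma (in semi_inner_product) norm_sip_le: "norm (sip x y) \<le> norm x * norm y"
proof -
  obtain t where "t \<ge> 0" "sip x x * sip y y = of_real ((norm (sip x y))\<^sup>2) + of_real t"
    using sip_Cauchy_Schwarz[of x y] unfolding less_eq_iff_real[where 'k = 'k] by blast
  then have "(of_real ((norm x)\<^sup>2 * (norm y)\<^sup>2) :: 'k) = of_real ((norm (sip x y))\<^sup>2 + t)"
    by (simp only: of_real_mult of_real_add sip_compatible)
  then have "(norm x * norm y)\<^sup>2 = (norm (sip x y))\<^sup>2 + t"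
    by (simp only: of_real_eq_iff power_mult_distrib)
  then show ?thesis using \<open>t \<ge> 0\<close> by (auto intro: power2_le_imp_le)
qed

section \<open>Constancy of the ratio of the two norms\<close>

text \<open>
  Here \<open>\<sigma> t\<close> is a slope of \<open>t \<mapsto> \<parallel>x + t y\<parallel>\<close>. In a step of length \<open>d\<close> the ratio
  \<open>r t = \<parallel>T (x + t y)\<parallel> / \<parallel>x + t y\<parallel>\<close> loses at most \<open>(B / m) d (\<sigma> (t + d) - \<sigma> t)\<close>.
  Over \<open>N\<close> steps of length \<open>1 / N\<close> these losses telescope to something of order \<open>1 / N\<close>.
\<close>

lemma ratio_mono_on_segment:
  fixes T :: "'x::real_normed_vector \<Rightarrow> 'y::real_normed_vector"
  assumes B: "\<And>z. norm (T z) \<le> B * norm z" "B \<ge> 0"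
    and support: "\<And>p. p \<noteq> 0 \<Longrightarrow> \<exists>\<phi>. linear \<phi> \<and> (\<forall>z. \<phi> z \<le> norm z) \<and> \<phi> p = norm p \<and>
      (\<forall>z. norm (T p) * \<phi> z \<le> norm p * norm (T z))"
    and m: "m > 0" "\<And>t. 0 \<le> t \<Longrightarrow> t \<le> 1 \<Longrightarrow> m \<le> norm (x + t *\<^sub>R y)"
  shows "norm (T x) / norm x \<le> norm (T (x + y)) / norm (x + y)"
proof -
  define P where "P t = x + t *\<^sub>R y" for t :: real
  define r where "r t = norm (T (P t)) / norm (P t)" for t
  have P_ge: "m \<le> norm (P t)" if "0 \<le> t" "t \<le> 1" for t
    using m(2)[OF that] by (simp add: P_def)
  \<comment> \<open>The implication sits under the quantifier so that a choice function is total;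
    its values outside the unit interval are arbitrary.\<close>
  have "\<exists>\<phi>. 0 \<le> t \<and> t \<le> 1 \<longrightarrow> linear \<phi> \<and> (\<forall>z. \<phi> z \<le> norm z) \<and> \<phi> (P t) = norm (P t) \<and>
      (\<forall>z. norm (T (P t)) * \<phi> z \<le> norm (P t) * norm (T z))" for t
    using support[of "P t"] P_ge[of t] m(1) by fastforce
  then obtain \<phi> where \<phi>: "\<And>t. 0 \<le> t \<and> t \<le> 1 \<longrightarrow> linear (\<phi> t) \<and> (\<forall>z. \<phi> t z \<le> norm z) \<and>
      \<phi> t (P t) = norm (P t) \<and> (\<forall>z. norm (T (P t)) * \<phi> t z \<le> norm (P t) * norm (T z))"
    by metis
  define \<sigma> where "\<sigma> t = \<phi> t y" for t
  have \<sigma>_le: "\<bar>\<sigma> t\<bar> \<le> norm y" if "0 \<le> t" "t \<le> 1" for t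
  proof -
    have lin: "linear (\<phi> t)" and le: "\<phi> t z \<le> norm z" for z using \<phi>[of t] that by auto
    show ?thesis using le[of y] le[of "- y"] linear_neg[OF lin, of y] by (simp add: \<sigma>_def)
  qed
  have \<phi>_P: "\<phi> t (P s) = norm (P t) + (s - t) * \<sigma> t" if "0 \<le> t" "t \<le> 1" for s t
  proof -
    have "P s = P t + (s - t) *\<^sub>R y" by (simp add: P_def algebra_simps)
    then show ?thesis using \<phi>[of t] that by (simp add: linear_add linear_scale \<sigma>_def)
  qed
  have step: "r t - B / m * d * (\<sigma> (t + d) - \<sigma> t) \<le> r (t + d)"
    if t: "0 \<le> t" "0 \<le> d" "t + d \<le> 1" for t d
  proof -
    define s where "s = t + d"
    have s: "0 \<le> s" "s \<le> 1" "t \<le> 1" using t by (auto simp: s_def)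
    define e where "e = d * (\<sigma> s - \<sigma> t)"
    have pos: "norm (P t) > 0" "norm (P s) > 0"
      using P_ge[of t] P_ge[of s] m(1) s t(1) by linarith+
    \<comment> \<open>Each support functional stays below the norm at the other point. Together the
      two inequalities say that slopes increase (\<open>e \<ge> 0\<close>) and that the tangent at
      \<open>t\<close> misses the norm at \<open>P s\<close> by at most \<open>e\<close>.\<close>
    have "\<phi> s (P t) \<le> norm (P t)" "\<phi> t (P s) \<le> norm (P s)"
      using \<phi>[of s] \<phi>[of t] s t(1) by auto
    then have lower: "norm (P s) - e \<le> \<phi> t (P s)" and "e \<ge> 0"
      using \<phi>_P[of s t] \<phi>_P[of t s] s t(1) by (simp_all add: s_def e_def algebra_simps)
    have r_t: "0 \<le> r t" "r t \<le> B"
      using pos B(1)[of "P t"] by (simp_all add: r_def divide_le_eq)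
    \<comment> \<open>The multiple \<open>r t\<close> of \<open>\<phi> t\<close> also lies below
      \<open>norm (T z)\<close>, which carries the estimate over to the numerator.\<close>
    have "r t * (norm (P s) - e) \<le> r t * \<phi> t (P s)"
      using lower r_t(1) by (rule mult_left_mono)
    also have "\<dots> \<le> norm (T (P s))"
    proof -
      have "norm (T (P t)) * \<phi> t (P s) \<le> norm (P t) * norm (T (P s))" using \<phi>[of t] s t(1) by blast
      then show ?thesis using pos by (simp add: r_def divide_le_eq mult.commute)
    qed
    also have "\<dots> = r s * norm (P s)" using pos by (simp add: r_def)
    finally have "(r t - r s) * norm (P s) \<le> r t * e" by (simp add: algebra_simps)
    also have "\<dots> \<le> B * e" using r_t(2) \<open>e \<ge> 0\<close> by (rule mult_right_mono)
    also have "\<dots> = (B * e / m) * m" using m(1) by simp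
    also have "\<dots> \<le> (B * e / m) * norm (P s)"
      using P_ge[of s] s m(1) B(2) \<open>e \<ge> 0\<close> by (intro mult_left_mono) simp_all
    finally have "r t - r s \<le> B * e / m" using pos by (simp only: mult_le_cancel_right_pos)
    then show ?thesis by (simp add: e_def s_def mult.assoc)
  qed
  have "r 0 - r 1 \<le> 2 * B * norm y / m * inverse (real (Suc n))" for n
  proof -
    define d where "d = inverse (real (Suc n))"
    have d: "d > 0" "real (Suc n) * d = 1" by (simp_all add: d_def)
    have "r 0 - B / m * d * (\<sigma> (real i * d) - \<sigma> 0) \<le> r (real i * d)" if "i \<le> Suc n" for i
      using that
    proof (induction i)
      case (Suc i)
      have eq: "real i * d + d = real (Suc i) * d" by (simp add: algebra_simps)
      have "real (Suc i) * d \<le> real (Suc n) * d"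
        using Suc.prems d(1) by (intro mult_right_mono) simp_all
      then have "r (real i * d) - B / m * d * (\<sigma> (real (Suc i) * d) - \<sigma> (real i * d))
          \<le> r (real (Suc i) * d)"
        unfolding d(2) using step[of "real i * d" d, unfolded eq] d(1) by simp
      moreover have "r 0 - B / m * d * (\<sigma> (real i * d) - \<sigma> 0) \<le> r (real i * d)"
        using Suc by simp
      ultimately show ?case unfolding right_diff_distrib by linarith
    qed simp
    from this[of "Suc n", unfolded d(2)] have "r 0 - r 1 \<le> B / m * d * (\<sigma> 1 - \<sigma> 0)" by simp
    also have "\<dots> \<le> B / m * d * (2 * norm y)"
      using \<sigma>_le[of 0] \<sigma>_le[of 1] B(2) m(1) d(1) by (intro mult_left_mono) auto
    finally show ?thesis by (simp add: d_def mult_ac)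
  qed
  moreover have "(\<lambda>n. 2 * B * norm y / m * inverse (real (Suc n))) \<longlonglongrightarrow> 0"
    using tendsto_mult_left[OF LIMSEQ_inverse_real_of_nat, of "2 * B * norm y / m"] by simp
  ultimately have "r 0 - r 1 \<le> 0" by (intro LIMSEQ_le_const) auto
  then show ?thesis by (simp add: r_def P_def)
qed

text \<open>A segment that avoids the origin stays away from it by compactness, and the previous
  estimate applies; one through the origin joins proportional vectors, whose ratios agree by
  linearity. Exchanging \<open>p\<close> and \<open>q\<close> yields equality.\<close>

lemma ratio_constant:
  fixes T :: "'x::real_normed_vector \<Rightarrow> 'y::real_normed_vector"
  assumes "linear T" and bounded: "\<exists>B. \<forall>z. norm (T z) \<le> B * norm z"
    and support: "\<And>p. p \<noteq> 0 \<Longrightarrow> \<exists>\<phi>. linear \<phi> \<and> (\<forall>z. \<phi> z \<le> norm z) \<and> \<phi> p = norm p \<and>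
      (\<forall>z. norm (T p) * \<phi> z \<le> norm p * norm (T z))"
    and "p \<noteq> 0" "q \<noteq> 0"
  shows "norm (T p) / norm p = norm (T q) / norm q"
proof -
  obtain B0 where B0: "\<And>z. norm (T z) \<le> B0 * norm z" using bounded by blast
  have B: "norm (T z) \<le> \<bar>B0\<bar> * norm z" for z
    using B0[of z] by (meson abs_ge_self mult_right_mono norm_ge_zero order_trans)
  have le: "norm (T p) / norm p \<le> norm (T q) / norm q" if "p \<noteq> 0" "q \<noteq> 0" for p q
  proof (cases "\<exists>t\<in>{0..1}. p + t *\<^sub>R (q - p) = 0")
    case True
    then obtain t where t: "p + t *\<^sub>R (q - p) = 0" by blast
    \<comment> \<open>Solves \<open>t *\<^sub>R q = (t - 1) *\<^sub>R p\<close> for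
      \<open>q\<close>; \<open>t = 0\<close> would give \<open>p = 0\<close>.\<close>
    define c where "c = (t - 1) / t"
    have "t \<noteq> 0" using t that by auto
    have "t *\<^sub>R q = (t - 1) *\<^sub>R p"
      using t by (simp add: algebra_simps)
    then have "inverse t *\<^sub>R t *\<^sub>R q = inverse t *\<^sub>R (t - 1) *\<^sub>R p" by (simp only:)
    then have q: "q = c *\<^sub>R p" using \<open>t \<noteq> 0\<close> by (simp add: c_def divide_inverse mult.commute)
    then have "c \<noteq> 0" using that by auto
    then show ?thesis by (simp add: q linear_scale[OF \<open>linear T\<close>])
  next
    case False
    obtain t0 where t0: "t0 \<in> {0..1}"
      and min: "\<And>t. t \<in> {0..1} \<Longrightarrow> norm (p + t0 *\<^sub>R (q - p)) \<le> norm (p + t *\<^sub>R (q - p))"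
    proof -
      have "continuous_on {0..1::real} (\<lambda>t. norm (p + t *\<^sub>R (q - p)))"
        by (intro continuous_intros)
      then show ?thesis
        using continuous_attains_inf[of "{0..1::real}" "\<lambda>t. norm (p + t *\<^sub>R (q - p))"] that by auto
    qed
    have "norm (T p) / norm p \<le> norm (T (p + (q - p))) / norm (p + (q - p))"
      using B _ support
    proof (rule ratio_mono_on_segment)
      show "norm (p + t0 *\<^sub>R (q - p)) > 0" using False t0 by auto
    qed (use min in auto)
    then show ?thesis by simp
  qed
  show ?thesis using le[of p q] le[of q p] assms by (intro antisym)
qed

section \<open>Level vectors\<close>

context bounded_operator
begin

lemma linear_real: "linear T"
  by (rule linearI) (simp_all add: add scale flip: X.scale_of_real Y.scale_of_real)

text \<open>The functional is the real part of \<open>sipX z p\<close>, divided by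
  \<open>norm p\<close>. The level identity at \<open>p\<close> itself determines
  \<open>norm k\<close>; Cauchy-Schwarz for \<open>sipY\<close> then bounds
  \<open>norm k * norm (sipX z p)\<close> by \<open>norm (T z) * norm (T p)\<close>.\<close>

lemma level_vector_support:
  assumes "level_vector scaleX scaleY T p"
  shows "\<exists>\<phi>. linear \<phi> \<and> (\<forall>z. \<phi> z \<le> norm z) \<and> \<phi> p = norm p \<and>
    (\<forall>z. norm (T p) * \<phi> z \<le> norm p * norm (T z))"
proof -
  from assms obtain k sipX sipY where "p \<noteq> 0"
    and sips: "semi_inner_product scaleX sipX" "semi_inner_product scaleY sipY"
    and level: "\<And>y. sipY (T y) (T p) = k * sipX y p"
    by (auto simp: level_vector_def)
  interpret sX: semi_inner_product scaleX sipX by fact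
  interpret sY: semi_inner_product scaleY sipY by fact
  obtain re :: "'k \<Rightarrow> real" where re: "\<And>a b. re (a + b) = re a + re b"
    "\<And>r a. re (of_real r * a) = r * re a" "\<And>r. re (of_real r) = r" "\<And>a. \<bar>re a\<bar> \<le> norm a"
    using rc_field_re by blast
  define \<phi> where "\<phi> z = re (sipX z p) / norm p" for z
  have k: "norm k * norm p * norm p = norm (T p) * norm (T p)"
  proof -
    have "of_real ((norm (T p))\<^sup>2) = k * of_real ((norm p)\<^sup>2)"
      using level[of p] by (simp only: sX.sip_compatible sY.sip_compatible)
    then have "norm (of_real ((norm (T p))\<^sup>2) :: 'k) = norm (k * of_real ((norm p)\<^sup>2))" by simp
    then show ?thesis by (simp add: norm_mult power2_eq_square)
  qed
  have "linear \<phi>"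
  proof (rule linearI)
    show "\<phi> (x + y) = \<phi> x + \<phi> y" for x y
      using sX.sip_linear[of 1 x 1 y p] by (simp add: \<phi>_def re add_divide_distrib)
    show "\<phi> (c *\<^sub>R x) = c *\<^sub>R \<phi> x" for c x
      using sX.sip_linear[of "of_real c" x 0 x p] by (simp add: \<phi>_def re X.scale_of_real)
  qed
  moreover have \<phi>_sip: "norm p * \<phi> z \<le> norm (sipX z p)" for z
    using re(4)[of "sipX z p"] \<open>p \<noteq> 0\<close> by (simp add: \<phi>_def)
  moreover have "\<phi> z \<le> norm z" for z
  proof -
    have "norm p * \<phi> z \<le> norm p * norm z"
      using \<phi>_sip[of z] sX.norm_sip_le[of z p] by (simp add: mult.commute)
    then show ?thesis using \<open>p \<noteq> 0\<close> by simp
  qed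
  moreover have "\<phi> p = norm p"
    using \<open>p \<noteq> 0\<close> unfolding \<phi>_def sX.sip_compatible[symmetric] re(3) by (simp add: power2_eq_square)
  moreover have "norm (T p) * \<phi> z \<le> norm p * norm (T z)" for z
  proof (cases "T p = 0")
    case False
    have "(norm (T p) * norm (T p)) * \<phi> z = norm k * norm p * (norm p * \<phi> z)"
      by (simp add: mult_ac flip: k)
    also have "\<dots> \<le> norm k * norm p * norm (sipX z p)"
      using \<phi>_sip[of z] by (intro mult_left_mono) simp_all
    also have "\<dots> = norm p * norm (sipY (T z) (T p))" by (simp add: level norm_mult)
    also have "\<dots> \<le> norm p * (norm (T z) * norm (T p))"
      using sY.norm_sip_le by (intro mult_left_mono) simp_all
    finally have "norm (T p) * (norm (T p) * \<phi> z) \<le> norm (T p) * (norm p * norm (T z))"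
      by (simp add: mult_ac)
    then show ?thesis using False by simp
  qed simp
  ultimately show ?thesis by blast
qed

lemma scalar_multiple_of_isometry_imp_level_vector:
  assumes "scalar_multiple_of_isometry T" "x \<noteq> 0"
  shows "level_vector scaleX scaleY T x"
proof -
  obtain c where c: "c \<ge> 0" "\<And>x. norm (T x) = c * norm x"
    using assms(1) by (auto simp: scalar_multiple_of_isometry_def)
  show ?thesis
  proof (cases "c = 0")
    case True
    obtain sipX sipY where sips: "semi_inner_product scaleX sipX" "semi_inner_product scaleY sipY"
      using X.semi_inner_product_exists Y.semi_inner_product_exists by blast
    interpret sY: semi_inner_product scaleY sipY by fact
    \<comment> \<open>Here \<open>T\<close> vanishes, so any two semi-inner products work with level
      number 0.\<close>
    have "sipY (T y) (T x) = 0 * sipX y x" for y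
      using c(2) True sY.sip_linear[of 0 0 0 0] by simp
    then show ?thesis using sips \<open>x \<noteq> 0\<close> unfolding level_vector_def by blast
  next
    case False
    obtain g where g: "Y.support_functional (T x) g" using Y.support_functional_exists by blast
    have "T x \<noteq> 0" using c(2)[of x] False \<open>x \<noteq> 0\<close> by auto
    obtain sipY where sipY: "semi_inner_product scaleY sipY" "\<And>y. sipY y (T x) = g y"
      using Y.semi_inner_product_extending[OF \<open>T x \<noteq> 0\<close> g] by blast
    \<comment> \<open>Since \<open>norm (T x) = c * norm x\<close>, both the bound and the value at
      \<open>x\<close> of the pullback carry a factor \<open>c\<^sup>2\<close>, which is divided out
      here and returns as the level number.\<close>
    have "X.support_functional x (\<lambda>y. g (T y) / of_real (c\<^sup>2))"
      unfolding X.support_functional_def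
    proof (intro conjI allI)
      fix y
      have "norm (g (T y)) \<le> norm (T x) * norm (T y)"
        using g by (simp add: Y.support_functional_def)
      moreover have "norm (of_real (c\<^sup>2) :: 'k) = c\<^sup>2" by (simp add: norm_power)
      ultimately show "norm (g (T y) / of_real (c\<^sup>2)) \<le> norm x * norm y"
        using False c(1) by (simp add: c(2) norm_divide field_simps power2_eq_square del: of_real_power)
    next
      show "g (T x) / of_real (c\<^sup>2) = of_real ((norm x)\<^sup>2)"
        using g False by (simp add: Y.support_functional_def c(2) power_mult_distrib)
    qed (use g in \<open>simp add: Y.support_functional_def add scale add_divide_distrib\<close>)
    then obtain sipX where sipX: "semi_inner_product scaleX sipX"
      "\<And>y. sipX y x = g (T y) / of_real (c\<^sup>2)"
      using X.semi_inner_product_extending[OF \<open>x \<noteq> 0\<close>] by blast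
    have "sipY (T y) (T x) = of_real (c\<^sup>2) * sipX y x" for y
      using False by (simp add: sipX(2) sipY(2))
    then show ?thesis
      using sipX(1) sipY(1) \<open>x \<noteq> 0\<close> unfolding level_vector_def by blast
  qed
qed

end

theorem theorem2p24:
  fixes scaleX :: "'k::rc_field \<Rightarrow> 'x::real_normed_vector \<Rightarrow> 'x"
    and scaleY :: "'k \<Rightarrow> 'y::real_normed_vector \<Rightarrow> 'y"
    and T :: "'x \<Rightarrow> 'y"
  assumes "bounded_operator scaleX scaleY T"
  shows "scalar_multiple_of_isometry T \<longleftrightarrow>
    (\<forall>x. x \<noteq> 0 \<longrightarrow> level_vector scaleX scaleY T x)"
proof -
  interpret bounded_operator scaleX scaleY T by fact
  show ?thesis
  proof
    assume level: "\<forall>x. x \<noteq> 0 \<longrightarrow> level_vector scaleX scaleY T x"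
    show "scalar_multiple_of_isometry T"
    proof (cases "\<exists>p::'x. p \<noteq> 0")
      case True
      then obtain p :: 'x where "p \<noteq> 0" by blast
      define c where "c = norm (T p) / norm p"
      have "norm (T x) / norm x = c" if "x \<noteq> 0" for x
        unfolding c_def using level that \<open>p \<noteq> 0\<close>
        by (intro ratio_constant[OF linear_real bounded level_vector_support]) blast+
      then have "norm (T x) = c * norm x" for x
        by (cases "x = 0") (auto simp: linear_0[OF linear_real] field_simps)
      moreover have "c \<ge> 0" by (simp add: c_def)
      ultimately show ?thesis unfolding scalar_multiple_of_isometry_def by blast
    next
      \<comment> \<open>The trivial space has no vector to define the ratio, and the factor 0
        serves.\<close>
      case False
      then have "norm (T x) = 0 * norm x" for x
        using linear_0[OF linear_real] by (metis norm_zero mult_zero_left)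
      then show ?thesis unfolding scalar_multiple_of_isometry_def by blast
    qed
  qed (blast intro: scalar_multiple_of_isometry_imp_level_vector)
qed

end
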